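(* Let $\theta\in(\pi/2,\pi)$, $0<\alpha_1,\alpha_2<1$, and let $\delta>0$ satisfy $$\delta\geq\max\Big\{\max_{j=1,2}\big\{2|\rho U(j)|,\ 4^{1/\alpha_j}|m_jB_{\alpha_j}^{-1}|^{1/\alpha_j}\big\},\ \big(32|m_1m_2B_{\alpha_1}^{-1}B_{\alpha_2}^{-1}|\big)^{1/(\alpha_1+\alpha_2)}\Big\}.$$ Let $G_{1,0},G_{2,0}$ be given initial values and let $G_1,G_2$ be the solution on $(0,T]$ of the Feynman-Kac system with two internal states described in the context. Then for $t\in(0,T]$ with $t>1/\delta$, for $q=0,1$, and for $j=1,2$ with $j^*$ determined by $j\cdot j^*=2$, $$\left|G_j^{(q)}(t)\right|\leq \frac{32|m_{j^*}B_{\alpha_{j^*}}^{-1}|}{\pi}\left(\frac{-1}{\cos\theta}\,t^{\alpha_{j^*}-q}e^{\cos\theta}+2\theta\,\delta^{q-\alpha_{j^*}}e^{\delta T}\right)|G_{j^*,0}|+\frac{8}{\pi}\left(\frac{-1}{\cos\theta}\,t^{-q}e^{\cos\theta}+2\theta\,\delta^{q}e^{\delta T}\right)|G_{j,0}|,$$ where $G_j^{(q)}=\partial^qG_j/\partial t^q$.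
   Context: Data: $p,b\in[0,1]$ with $p+b\neq1$; $B_{\alpha_1}^{-1},B_{\alpha_2}^{-1}$ given positive reals; $U(1),U(2)$ given values; $\rho$ a fixed parameter; $m_1=\frac{1-p}{1-p-b}$, $m_2=\frac{1-b}{1-p-b}$. Powers are principal branches. System on $(0,T]$, with $G_j(0)=G_{j,0}$: $$(\partial_t+\rho U(1))G_1=m_1B_{\alpha_1}^{-1}\mathfrak D_t^{1-\alpha_1}G_1-m_2B_{\alpha_2}^{-1}\mathfrak D_t^{1-\alpha_2}G_2,$$ $$(\partial_t+\rho U(2))G_2=-m_1B_{\alpha_1}^{-1}\mathfrak D_t^{1-\alpha_1}G_1+m_2B_{\alpha_2}^{-1}\mathfrak D_t^{1-\alpha_2}G_2,$$ where $\mathfrak D_t^{1-\alpha_j}G_j(t)=(\partial_t+\rho U(j))\frac1{\Gamma(\alpha_j)}\int_0^t\frac{e^{-(t-\tau)\rho U(j)}}{(t-\tau)^{1-\alpha_j}}G_j(\tau)\,d\tau$ is the fractional substantial derivative. Put $$H(z)=\Big\{[(z+\rho U(1))^{\alpha_1}-m_1B_{\alpha_1}^{-1}][(z+\rho U(2))^{\alpha_2}-m_2B_{\alpha_2}^{-1}]-m_1m_2B_{\alpha_1}^{-1}B_{\alpha_2}^{-1}\Big\}^{-1},$$ $H_{\alpha_1}(z)=H(z)\big((z+\rho U(2))^{\alpha_2}-m_2B_{\alpha_2}^{-1}\big)$ and $H_{\alpha_2}(z)=H(z)\big((z+\rho U(1))^{\alpha_1}-m_1B_{\alpha_1}^{-1}\big)$.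 It is assumed that $G_j\in I_{0^+}^{1-\alpha_j}[L_1(0,T)]$ (the range of the Riemann-Liouville integral of order $1-\alpha_j$ on $L_1(0,T)$), so that the Laplace transforms of the solution are $$\widehat G_j(z)=H_{\alpha_j}(z)(z+\rho U(j))^{\alpha_j-1}G_{j,0}-m_{j^*}B_{\alpha_{j^*}}^{-1}H(z)(z+\rho U(j))^{\alpha_j-1}G_{j^*,0},\qquad j\cdot j^*=2.$$ The solution is represented by the inverse Laplace transform $G_j(t)=\frac1{2\pi i}\int_{\Gamma_{\theta,\delta}}e^{zt}\widehat G_j(z)\,dz$, where $\Gamma_{\theta,\delta}=\{|z|=\delta,\ |\arg z|\le\theta\}\cup\{z=re^{\pm i\theta},\ r\ge\delta\}$ is oriented with increasing imaginary part. *)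

theory Defs
  imports "HOL-Complex_Analysis.Complex_Analysis"
begin

text \<open>
  The two internal states are the indices \<open>1, 2 :: nat\<close>; the other values of an indexed
  family are never used. \<open>B j\<close> stands for $B_{\alpha_j}$. Complex powers are principal
  branches, \<open>z powr w = exp (w * Ln z)\<close>. The parameter \<open>\<rho>\<close> and the values \<open>U j\<close> are allowed
  to be complex, which includes the real case.
\<close>

definition m_coeff :: "real \<Rightarrow> real \<Rightarrow> nat \<Rightarrow> real" where
  "m_coeff p b j = (if j = 1 then (1 - p) / (1 - p - b) else (1 - b) / (1 - p - b))"

text \<open>The index $j^*$ determined by $j \cdot j^* = 2$.\<close>

definition star :: "nat \<Rightarrow> nat" where
  "star j = 2 div j"


subsection \<open>Fractional operators\<close>

definition RL_integral :: "real \<Rightarrow> (real \<Rightarrow> complex) \<Rightarrow> real \<Rightarrow> complex" where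
  "RL_integral \<beta> \<phi> t =
     (1 / Gamma \<beta>) *\<^sub>R (LINT \<tau>:{0<..<t}|lborel. ((t - \<tau>) powr (\<beta> - 1)) *\<^sub>R \<phi> \<tau>)"

text \<open>
  Membership in the range of the Riemann--Liouville integral on $L_1(0,T)$; elements of
  $L_1$ are classes of functions, so the identity is required almost everywhere.
\<close>

definition in_RL_range :: "real \<Rightarrow> real \<Rightarrow> (real \<Rightarrow> complex) \<Rightarrow> bool" where
  "in_RL_range \<beta> T f \<longleftrightarrow>
     (\<exists>\<phi>. set_integrable lborel {0<..<T} \<phi> \<and>
          (AE t in lborel. t \<in> {0<..<T} \<longrightarrow> f t = RL_integral \<beta> \<phi> t))"

text \<open>
  Time derivative on $(0,T]$ (one-sided at \<open>T\<close>), and its iterates. As \<open>vector_derivative\<close> is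
  total, differentiability is stated separately where it is needed.
\<close>

definition dt :: "real \<Rightarrow> (real \<Rightarrow> complex) \<Rightarrow> real \<Rightarrow> complex" where
  "dt T f t = vector_derivative f (at t within {0<..T})"

definition dt_iter :: "real \<Rightarrow> nat \<Rightarrow> (real \<Rightarrow> complex) \<Rightarrow> real \<Rightarrow> complex" where
  "dt_iter T q = (dt T ^^ q)"

text \<open>In the next two definitions \<open>s\<close> is $\rho U(j)$.\<close>

definition subst_integral :: "real \<Rightarrow> complex \<Rightarrow> (real \<Rightarrow> complex) \<Rightarrow> real \<Rightarrow> complex" where
  "subst_integral \<alpha> s f t =
     (1 / Gamma \<alpha>) *\<^sub>R
       (LINT \<tau>:{0<..<t}|lborel.
          exp (- (of_real (t - \<tau>) * s)) / of_real ((t - \<tau>) powr (1 - \<alpha>)) * f \<tau>)"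

definition subst_deriv :: "real \<Rightarrow> real \<Rightarrow> complex \<Rightarrow> (real \<Rightarrow> complex) \<Rightarrow> real \<Rightarrow> complex" where
  "subst_deriv T \<alpha> s f t =
     dt T (subst_integral \<alpha> s f) t + s * subst_integral \<alpha> s f t"


subsection \<open>The Feynman--Kac system with two internal states\<close>

definition FK_solution ::
  "real \<Rightarrow> real \<Rightarrow> (nat \<Rightarrow> real) \<Rightarrow> (nat \<Rightarrow> real) \<Rightarrow> complex \<Rightarrow> (nat \<Rightarrow> complex) \<Rightarrow>
   real \<Rightarrow> (nat \<Rightarrow> complex) \<Rightarrow> (nat \<Rightarrow> real \<Rightarrow> complex) \<Rightarrow> bool" where
  "FK_solution p b \<alpha> B \<rho> U T G0 G \<longleftrightarrow>
     (\<forall>j\<in>{1, 2}.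
        continuous_on {0..T} (G j) \<and> G j 0 = G0 j \<and>
        in_RL_range (1 - \<alpha> j) T (G j) \<and>
        (\<forall>t\<in>{0<..T}. G j differentiable (at t within {0<..T}) \<and>
            subst_integral (\<alpha> j) (\<rho> * U j) (G j) differentiable (at t within {0<..T}))) \<and>
     (\<forall>t\<in>{0<..T}.
        dt T (G 1) t + \<rho> * U 1 * G 1 t =
            of_real (m_coeff p b 1 * inverse (B 1)) * subst_deriv T (\<alpha> 1) (\<rho> * U 1) (G 1) t
          - of_real (m_coeff p b 2 * inverse (B 2)) * subst_deriv T (\<alpha> 2) (\<rho> * U 2) (G 2) t \<and>
        dt T (G 2) t + \<rho> * U 2 * G 2 t =
          - of_real (m_coeff p b 1 * inverse (B 1)) * subst_deriv T (\<alpha> 1) (\<rho> * U 1) (G 1) t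
          + of_real (m_coeff p b 2 * inverse (B 2)) * subst_deriv T (\<alpha> 2) (\<rho> * U 2) (G 2) t)"


subsection \<open>Laplace transforms of the solution and the inversion contour\<close>

text \<open>The factor $(z + \rho U(j))^{\alpha_j} - m_j B_{\alpha_j}^{-1}$.\<close>

definition FK_factor ::
  "real \<Rightarrow> real \<Rightarrow> (nat \<Rightarrow> real) \<Rightarrow> (nat \<Rightarrow> real) \<Rightarrow> complex \<Rightarrow> (nat \<Rightarrow> complex) \<Rightarrow>
   nat \<Rightarrow> complex \<Rightarrow> complex" where
  "FK_factor p b \<alpha> B \<rho> U j z =
     (z + \<rho> * U j) powr of_real (\<alpha> j) - of_real (m_coeff p b j * inverse (B j))"

definition FK_H ::
  "real \<Rightarrow> real \<Rightarrow> (nat \<Rightarrow> real) \<Rightarrow> (nat \<Rightarrow> real) \<Rightarrow> complex \<Rightarrow> (nat \<Rightarrow> complex) \<Rightarrow>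
   complex \<Rightarrow> complex" where
  "FK_H p b \<alpha> B \<rho> U z =
     inverse (FK_factor p b \<alpha> B \<rho> U 1 z * FK_factor p b \<alpha> B \<rho> U 2 z
              - of_real (m_coeff p b 1 * m_coeff p b 2 * inverse (B 1) * inverse (B 2)))"

definition FK_H_alpha ::
  "real \<Rightarrow> real \<Rightarrow> (nat \<Rightarrow> real) \<Rightarrow> (nat \<Rightarrow> real) \<Rightarrow> complex \<Rightarrow> (nat \<Rightarrow> complex) \<Rightarrow>
   nat \<Rightarrow> complex \<Rightarrow> complex" where
  "FK_H_alpha p b \<alpha> B \<rho> U j z = FK_H p b \<alpha> B \<rho> U z * FK_factor p b \<alpha> B \<rho> U (star j) z"

definition FK_Ghat ::
  "real \<Rightarrow> real \<Rightarrow> (nat \<Rightarrow> real) \<Rightarrow> (nat \<Rightarrow> real) \<Rightarrow> complex \<Rightarrow> (nat \<Rightarrow> complex) \<Rightarrow>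
   (nat \<Rightarrow> complex) \<Rightarrow> nat \<Rightarrow> complex \<Rightarrow> complex" where
  "FK_Ghat p b \<alpha> B \<rho> U G0 j z =
     FK_H_alpha p b \<alpha> B \<rho> U j z * (z + \<rho> * U j) powr of_real (\<alpha> j - 1) * G0 j
     - of_real (m_coeff p b (star j) * inverse (B (star j))) * FK_H p b \<alpha> B \<rho> U z
         * (z + \<rho> * U j) powr of_real (\<alpha> j - 1) * G0 (star j)"

text \<open>
  The integral over $\Gamma_{\theta,\delta}$ oriented with increasing imaginary part: the
  lower ray is traversed from infinity to $\delta e^{-i\theta}$ (hence the minus sign), then
  the circular arc counterclockwise, then the upper ray out to infinity. The library's
  \<open>contour_integral\<close> is for bounded paths only, so the rays are Lebesgue integrals in \<open>r\<close>.
\<close>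

definition Gamma_contour_integral ::
  "real \<Rightarrow> real \<Rightarrow> (complex \<Rightarrow> complex) \<Rightarrow> complex" where
  "Gamma_contour_integral \<theta> \<delta> f =
     - (LINT r:{\<delta>..}|lborel. f (of_real r * cis (- \<theta>)) * cis (- \<theta>))
     + contour_integral (part_circlepath 0 \<delta> (- \<theta>) \<theta>) f
     + (LINT r:{\<delta>..}|lborel. f (of_real r * cis \<theta>) * cis \<theta>)"

end

theory Submission
  imports Defs
begin

text \<open>
  On $|z| \ge \delta$ the hypotheses on $\delta$ make each factor
  $(z + \rho U(j))^{\alpha_j} - m_j B_{\alpha_j}^{-1}$ at least half as large as its power term,
  and the coupling constant at most half of the product of the two factors. Hence
  $|\widehat G_j(z)| \le 8 |G_{j,0}| |z|^{-1}
    + 32 |m_{j^*} B_{\alpha_{j^*}}^{-1}| |G_{j^*,0}| |z|^{-1-\alpha_{j^*}}$,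
  and integrating $|z|^q |e^{zt}| |\widehat G_j(z)|$ over the contour gives the estimate: on the
  rays $|z| \ge \delta > 1/t$, so the negative powers of $|z|$ are at most powers of $t$.

  For $q = 1$ no differentiation under the integral sign is needed. As $G_j$ is known to be
  differentiable, it is enough to bound the difference quotient between $s$ and $t$ for
  $1/\delta < s < t$; on the rays
  $|e^{zs} - e^{zt}| \le (t - s) |z| e^{s \Re z}$, so the quotient obeys the claimed bound at $s$.
\<close>

section \<open>Elementary estimates for powers and exponentials\<close>

text \<open>Converts the lower bounds on \<delta>, which carry reciprocal exponents, into lower
  bounds for powers of |z|.\<close>

lemma powr_le_imp_le_powr:
  fixes x a d :: real
  assumes "x powr (1 / a) \<le> d" "0 \<le> x" "0 < a"
  shows "x \<le> d powr a"
proof -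
  have "x = (x powr (1 / a)) powr a"
    using assms by (simp add: powr_powr)
  also have "\<dots> \<le> d powr a"
    using assms by (intro powr_mono2) auto
  finally show ?thesis .
qed

text \<open>The shift removes at most half of the modulus, and the resulting factor
  \<open>2 powr a\<close> is at most 2 because a < 1.\<close>

lemma powr_le_two_powr_shift:
  fixes z w :: complex and a :: real
  assumes "2 * cmod w \<le> cmod z" "0 < a" "a < 1"
  shows "cmod z powr a \<le> 2 * cmod (z + w) powr a"
proof -
  have "cmod z / 2 \<le> cmod (z + w)"
    using norm_triangle_ineq2[of z "- w"] assms(1) by simp
  hence "(cmod z / 2) powr a \<le> cmod (z + w) powr a"
    using assms by (intro powr_mono2) auto
  moreover have "cmod z powr a = 2 powr a * (cmod z / 2) powr a"
    by (simp flip: powr_mult)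
  moreover have "2 powr a \<le> (2::real) powr 1"
    using assms by (intro powr_mono) auto
  ultimately show ?thesis
    using mult_mono[of "2 powr a" 2 "(cmod z / 2) powr a" "cmod (z + w) powr a"] by simp
qed

text \<open>Mean value inequality on the convex half-plane Re z \<le> m, where the derivative of exp
  has modulus at most \<open>exp m\<close>.\<close>

lemma norm_exp_diff_le:
  fixes x y :: complex
  assumes "Re x \<le> m" "Re y \<le> m"
  shows "cmod (exp x - exp y) \<le> exp m * cmod (x - y)"
proof (rule field_differentiable_bound)
  show "convex {z. Re z \<le> m}" by (rule convex_halfspace_Re_le)
  show "(exp has_field_derivative exp z) (at z within {z. Re z \<le> m})" for z
    by (rule DERIV_exp[THEN DERIV_subset]) auto
qed (use assms in auto)

section \<open>Integrability and size of integrals over the contour\<close>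

text \<open>The integrand is nonnegative, so one computation with the primitive
  \<open>exp (r * c) / c\<close>, which vanishes at infinity, yields both integrability and the
  value.\<close>

lemma integrable_exp_ray:
  fixes c d :: real
  assumes "c < 0"
  shows "set_integrable lborel {d..} (\<lambda>r. exp (r * c))"
    and "(LINT r:{d..}|lborel. exp (r * c)) = exp (d * c) / - c"
proof -
  have tend: "((\<lambda>r. exp (r * c) / c) \<longlongrightarrow> 0) at_top"
  proof -
    have "((\<lambda>r. exp (- (r * - c)) / c) \<longlongrightarrow> 0 / c) at_top"
      using assms
      by (intro tendsto_intros filterlim_compose[OF exp_at_bot]
            filterlim_compose[OF filterlim_uminus_at_bot_at_top]
            filterlim_at_top_mult_tendsto_pos[OF tendsto_const _ filterlim_ident]) auto
    thus ?thesis by simp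
  qed
  have "(\<integral>\<^sup>+ r. ennreal (exp (r * c)) * indicator {d..} r \<partial>lborel) = 0 - exp (d * c) / c"
    by (rule nn_integral_FTC_atLeast[where F = "\<lambda>r. exp (r * c) / c", OF _ _ _ tend])
      (use assms in \<open>auto intro!: derivative_eq_intros\<close>)
  hence "(\<integral>\<^sup>+ r. ennreal (indicator {d..} r *\<^sub>R exp (r * c)) \<partial>lborel) = ennreal (exp (d * c) / - c)"
    by (simp add: indicator_mult_ennreal mult.commute)
  hence "has_bochner_integral lborel (\<lambda>r. indicator {d..} r *\<^sub>R exp (r * c)) (exp (d * c) / - c)"
    using assms by (intro has_bochner_integral_nn_integral) (auto simp: divide_nonneg_neg)
  thus "set_integrable lborel {d..} (\<lambda>r. exp (r * c))"
    "(LINT r:{d..}|lborel. exp (r * c)) = exp (d * c) / - c"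
    by (auto simp: set_integrable_def set_lebesgue_integral_def has_bochner_integral_iff)
qed

lemma ray_integral_bound:
  fixes f :: "real \<Rightarrow> complex"
  assumes "c < 0" and [measurable]: "f \<in> borel_measurable borel"
    and le: "\<And>r. d \<le> r \<Longrightarrow> cmod (f r) \<le> K * exp (r * c)"
  shows "set_integrable lborel {d..} f"
    and "cmod (LINT r:{d..}|lborel. f r) \<le> K * (exp (d * c) / - c)"
proof -
  have g: "set_integrable lborel {d..} (\<lambda>r. K * exp (r * c))"
    by (intro set_integrable_mult_right integrable_exp_ray assms)
  show f: "set_integrable lborel {d..} f"
    by (rule set_integrable_bound[OF g]) 
       (use le in \<open>force simp: set_borel_measurable_def intro!: AE_I2 order.trans[OF le]\<close>)+
  have "cmod (LINT r:{d..}|lborel. f r) \<le> (LINT r:{d..}|lborel. cmod (f r))"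
    by (rule set_integral_norm_bound[OF f])
  also have "\<dots> \<le> (LINT r:{d..}|lborel. K * exp (r * c))"
    by (rule set_integral_mono[OF set_integrable_norm[OF f] g]) (use le in auto)
  also have "\<dots> = K * (exp (d * c) / - c)"
    using integrable_exp_ray(2)[OF assms(1), of d] by simp
  finally show "cmod (LINT r:{d..}|lborel. f r) \<le> K * (exp (d * c) / - c)" .
qed

text \<open>The parameter interval has finite length, so boundedness and measurability suffice; this
  admits integrands that jump where the arc crosses a branch cut.\<close>

lemma contour_integrable_arc:
  fixes f :: "complex \<Rightarrow> complex"
  assumes [measurable]: "f \<in> borel_measurable borel" and "a < b"
    and le: "\<And>x. x \<in> {a..b} \<Longrightarrow> cmod (f (of_real d * cis x)) \<le> M"
  shows "f contour_integrable_on part_circlepath 0 d a b"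
proof -
  have [measurable]: "cis \<in> borel_measurable borel"
    by (intro borel_measurable_continuous_onI continuous_intros)
  have "set_integrable lborel {a..b} (\<lambda>t. f (0 + d * cis t) * d * \<i> * cis t)"
    unfolding set_integrable_def
  proof (rule integrableI_bounded_set[where A = "{a..b}" and B = "M * \<bar>d\<bar>"])
    show "AE x in lborel. x \<in> {a..b} \<longrightarrow>
        cmod (indicat_real {a..b} x *\<^sub>R (f (0 + d * cis x) * d * \<i> * cis x)) \<le> M * \<bar>d\<bar>"
      using le by (auto intro!: AE_I2 mult_right_mono simp: norm_mult)
  qed (auto simp: emeasure_lborel_Icc_eq)
  thus ?thesis
    unfolding contour_integrable_part_circlepath_iff[OF \<open>a < b\<close>]
    by (rule set_borel_integral_eq_integral)
qed

text \<open>Both kinds of integral default to 0 on non-integrable functions, so additivity of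
  \<open>Gamma_contour_integral\<close> rests on integrability over all three pieces.\<close>

definition Gamma_contour_integrable :: "real \<Rightarrow> real \<Rightarrow> (complex \<Rightarrow> complex) \<Rightarrow> bool" where
  "Gamma_contour_integrable \<theta> \<delta> f \<longleftrightarrow>
     (\<forall>\<phi>\<in>{- \<theta>, \<theta>}. set_integrable lborel {\<delta>..} (\<lambda>r. f (of_real r * cis \<phi>) * cis \<phi>)) \<and>
     f contour_integrable_on part_circlepath 0 \<delta> (- \<theta>) \<theta>"

lemma Gamma_contour_integral_diff:
  assumes "Gamma_contour_integrable \<theta> \<delta> f" "Gamma_contour_integrable \<theta> \<delta> g"
  shows "Gamma_contour_integral \<theta> \<delta> (\<lambda>z. f z - g z)
    = Gamma_contour_integral \<theta> \<delta> f - Gamma_contour_integral \<theta> \<delta> g"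
  using assms
  by (simp add: Gamma_contour_integrable_def Gamma_contour_integral_def left_diff_distrib
      contour_integral_diff set_integral_diff)

text \<open>Each ray contributes at most the integral of its exponential majorant over r \<ge>
  \<delta>, and the arc at most its length 2\<theta>\<delta> times M.\<close>

lemma Gamma_contour_integral_bound:
  fixes f :: "complex \<Rightarrow> complex"
  assumes f: "f \<in> borel_measurable borel" and "0 < \<theta>" "0 < \<delta>" "0 < s" "cos \<theta> < 0"
    and rays: "\<And>r \<phi>. \<delta> \<le> r \<Longrightarrow> \<phi> \<in> {- \<theta>, \<theta>} \<Longrightarrow>
                 cmod (f (of_real r * cis \<phi>)) \<le> K * exp (r * (s * cos \<theta>))"
    and arc: "\<And>\<phi>. \<phi> \<in> {- \<theta>..\<theta>} \<Longrightarrow> cmod (f (of_real \<delta> * cis \<phi>)) \<le> M"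
  shows "Gamma_contour_integrable \<theta> \<delta> f"
    and "cmod (Gamma_contour_integral \<theta> \<delta> f) \<le>
      2 * K * (exp (\<delta> * (s * cos \<theta>)) / - (s * cos \<theta>)) + 2 * \<theta> * \<delta> * M"
proof -
  note [measurable] = f
  have c: "s * cos \<theta> < 0"
    using assms by (simp add: mult_pos_neg)
  have ray: "set_integrable lborel {\<delta>..} (\<lambda>r. f (of_real r * cis \<phi>) * cis \<phi>) \<and>
    cmod (LINT r:{\<delta>..}|lborel. f (of_real r * cis \<phi>) * cis \<phi>)
      \<le> K * (exp (\<delta> * (s * cos \<theta>)) / - (s * cos \<theta>))" if "\<phi> \<in> {- \<theta>, \<theta>}" for \<phi>
    using rays that by (intro conjI ray_integral_bound[OF c]) (auto simp: norm_mult)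
  have ci: "f contour_integrable_on part_circlepath 0 \<delta> (- \<theta>) \<theta>"
    by (rule contour_integrable_arc[OF f _ arc]) (use assms in auto)
  with ray show "Gamma_contour_integrable \<theta> \<delta> f"
    unfolding Gamma_contour_integrable_def by blast
  have "0 \<le> M"
    using order.trans[OF norm_ge_zero arc[of 0]] \<open>0 < \<theta>\<close> by simp
  moreover have "closed_segment (- \<theta>) \<theta> = {- \<theta>..\<theta>}"
    using \<open>0 < \<theta>\<close> by (simp add: closed_segment_eq_real_ivl)
  ultimately have "cmod (contour_integral (part_circlepath 0 \<delta> (- \<theta>) \<theta>) f) \<le> M * \<delta> * \<bar>\<theta> - - \<theta>\<bar>"
    using \<open>0 < \<delta>\<close> arc
    by (intro contour_integral_bound_part_circlepath[OF ci]) (auto simp: path_image_part_circlepath')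
  also have "\<dots> = 2 * \<theta> * \<delta> * M"
    using \<open>0 < \<theta>\<close> by simp
  finally have "cmod (contour_integral (part_circlepath 0 \<delta> (- \<theta>) \<theta>) f) \<le> 2 * \<theta> * \<delta> * M" .
  moreover have "cmod (- x + y + z) \<le> cmod x + cmod y + cmod z" for x y z
    by (metis add_right_mono norm_minus_cancel norm_triangle_ineq norm_triangle_le)
  ultimately have "cmod (Gamma_contour_integral \<theta> \<delta> f) \<le>
      K * (exp (\<delta> * (s * cos \<theta>)) / - (s * cos \<theta>)) + 2 * \<theta> * \<delta> * M
      + K * (exp (\<delta> * (s * cos \<theta>)) / - (s * cos \<theta>))"
    unfolding Gamma_contour_integral_def
    using conjunct2[OF ray[of \<theta>]] conjunct2[OF ray[of "- \<theta>"]]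
    by (meson add_mono insertCI order.trans)
  thus "cmod (Gamma_contour_integral \<theta> \<delta> f) \<le>
      2 * K * (exp (\<delta> * (s * cos \<theta>)) / - (s * cos \<theta>)) + 2 * \<theta> * \<delta> * M"
    by simp
qed

section \<open>Pointwise bounds on the Laplace transforms\<close>

lemma norm_powr_of_real_exponent:
  fixes z :: complex
  shows "cmod (z powr of_real a) = cmod z powr a"
  by (cases "z = 0") (simp_all add: powr_def)

text \<open>Subtracting c and d at most halves |X| and |Y|, so P * Q \<ge> |X| |Y| / 4 \<ge> 2 |c d|
  for the moduli P, Q of the two differences, and the denominator of H keeps at least half of P *
  Q.\<close>

lemma resolvent_bounds:
  fixes X Y :: complex and c d :: real
  assumes "X \<noteq> 0" "Y \<noteq> 0" "2 * \<bar>c\<bar> \<le> cmod X" "2 * \<bar>d\<bar> \<le> cmod Y" "8 * \<bar>c * d\<bar> \<le> cmod X * cmod Y"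
  defines "H \<equiv> inverse ((X - of_real c) * (Y - of_real d) - of_real (c * d))"
  shows "cmod H \<le> 8 / (cmod X * cmod Y)" and "cmod (H * (Y - of_real d)) \<le> 4 / cmod X"
proof -
  define P where "P = cmod (X - of_real c)"
  define Q where "Q = cmod (Y - of_real d)"
  have P: "cmod X / 2 \<le> P"
    using norm_triangle_ineq2[of X "of_real c"] assms(3) by (simp add: P_def)
  have Q: "cmod Y / 2 \<le> Q"
    using norm_triangle_ineq2[of Y "of_real d"] assms(4) by (simp add: Q_def)
  have "0 < cmod X" "0 < cmod Y"
    using assms(1,2) by simp_all
  with P Q have pos: "0 < cmod X" "0 < cmod Y" "0 < P" "0 < Q"
    by linarith+
  have "cmod X / 2 * (cmod Y / 2) \<le> P * Q"
    using P Q by (intro mult_mono) (auto simp: P_def)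
  hence XY: "cmod X * cmod Y \<le> 4 * (P * Q)" by simp
  have "P * Q - \<bar>c * d\<bar> \<le> cmod ((X - of_real c) * (Y - of_real d) - of_real (c * d))"
    using norm_triangle_ineq2[of "(X - of_real c) * (Y - of_real d)" "of_real (c * d)"]
    by (simp add: P_def Q_def norm_mult abs_mult)
  hence "P * Q / 2 \<le> cmod ((X - of_real c) * (Y - of_real d) - of_real (c * d))"
    using XY assms(5) by linarith
  hence H: "cmod H \<le> 2 / (P * Q)"
    using pos unfolding H_def norm_inverse
    by (metis (no_types, lifting) inverse_divide le_imp_inverse_le mult_pos_pos half_gt_zero)
  also have "\<dots> \<le> 8 / (cmod X * cmod Y)"
    using XY pos by (simp add: field_simps)
  finally show "cmod H \<le> 8 / (cmod X * cmod Y)" .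
  \<comment> \<open>The factor cancels exactly against Q, so no upper bound on it in terms of |Y|
    enters.\<close>
  have "cmod (H * (Y - of_real d)) \<le> 2 / (P * Q) * Q"
    unfolding norm_mult Q_def[symmetric] using H pos by (intro mult_right_mono) auto
  also have "\<dots> = 2 / P" using pos by simp
  also have "\<dots> \<le> 4 / cmod X"
    using P pos by (simp add: field_simps)
  finally show "cmod (H * (Y - of_real d)) \<le> 4 / cmod X" .
qed

text \<open>With \<open>w k\<close> the shifted variable and \<open>X k\<close> its power,
  \<open>w j powr (\<alpha> j - 1)\<close> has modulus |X j| / |w j|, whose numerator cancels |X j|
  in the resolvent bounds. There remain 4 / |w j| and 8 / (|w j| |X i|); each passage to a power of
  |z| costs a factor 2, whence 8 and 32.\<close>

lemma norm_FK_Ghat_le: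
  fixes z :: complex and p b :: real and \<alpha> B :: "nat \<Rightarrow> real"
  defines "c \<equiv> \<lambda>k. m_coeff p b k * inverse (B k)"
  assumes j: "j \<in> {1, 2}" and z: "z \<noteq> 0"
    and \<alpha>: "\<And>k. k \<in> {1, 2} \<Longrightarrow> 0 < \<alpha> k \<and> \<alpha> k < 1"
    and shift: "\<And>k. k \<in> {1, 2} \<Longrightarrow> 2 * cmod (\<rho> * U k) \<le> cmod z"
    and c: "\<And>k. k \<in> {1, 2} \<Longrightarrow> 4 * \<bar>c k\<bar> \<le> cmod z powr \<alpha> k"
    and cc: "32 * \<bar>c 1 * c 2\<bar> \<le> cmod z powr (\<alpha> 1 + \<alpha> 2)"
  shows "cmod (FK_Ghat p b \<alpha> B \<rho> U G0 j z) \<le>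
    8 * cmod (G0 j) * cmod z powr (- 1)
    + 32 * \<bar>c (star j)\<bar> * cmod (G0 (star j)) * cmod z powr (- 1 - \<alpha> (star j))"
proof -
  define i where "i = star j"
  have i: "i \<in> {1, 2}" and ij: "(i = 1 \<and> j = 2) \<or> (i = 2 \<and> j = 1)"
    using j by (auto simp: i_def star_def)
  define w where "w = (\<lambda>k. z + \<rho> * U k)"
  define X where "X = (\<lambda>k. w k powr of_real (\<alpha> k))"
  define r where "r = cmod z"
  have r: "0 < r" using z by (simp add: r_def)
  have w: "r \<le> 2 * cmod (w k)" if "k \<in> {1, 2}" for k
    using norm_triangle_ineq2[of z "- (\<rho> * U k)"] shift[OF that] by (simp add: w_def r_def)
  have w0: "w k \<noteq> 0" if "k \<in> {1, 2}" for k
    using w[OF that] r by auto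
  have nX: "cmod (X k) = cmod (w k) powr \<alpha> k" for k
    by (simp add: X_def norm_powr_of_real_exponent)
  have rX: "r powr \<alpha> k \<le> 2 * cmod (X k)" if "k \<in> {1, 2}" for k
    using powr_le_two_powr_shift[of "\<rho> * U k" z "\<alpha> k"] shift[OF that] \<alpha>[OF that]
    by (simp add: nX w_def r_def)
  have X0: "X k \<noteq> 0" if "k \<in> {1, 2}" for k
    using w0[OF that] by (simp add: X_def)
  have cX: "2 * \<bar>c k\<bar> \<le> cmod (X k)" if "k \<in> {1, 2}" for k
    using c[OF that] rX[OF that] by (simp add: r_def)
  \<comment> \<open>The two factors 2 lost in \<open>rX\<close> turn the 32 of \<open>cc\<close>
    into the 8 that \<open>resolvent_bounds\<close> asks for.\<close>
  have "r powr \<alpha> j * r powr \<alpha> i \<le> 2 * cmod (X j) * (2 * cmod (X i))"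
    using rX i j by (intro mult_mono) auto
  hence ccX: "8 * \<bar>c j * c i\<bar> \<le> cmod (X j) * cmod (X i)"
    using cc ij by (auto simp: r_def powr_add mult.commute)
  \<comment> \<open>The denominator is symmetric in the two states, so both values of j are treated
    at once.\<close>
  have H: "FK_H p b \<alpha> B \<rho> U z
      = inverse ((X j - of_real (c j)) * (X i - of_real (c i)) - of_real (c j * c i))"
    using ij by (auto simp: FK_H_def FK_factor_def X_def w_def c_def mult_ac)
  note res = resolvent_bounds[OF X0[OF j] X0[OF i] cX[OF j] cX[OF i] ccX, folded H]
  have F: "FK_factor p b \<alpha> B \<rho> U i z = X i - of_real (c i)"
    by (simp add: FK_factor_def X_def w_def c_def)
  have pw: "cmod (w j powr of_real (\<alpha> j - 1)) = cmod (X j) / cmod (w j)"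
    unfolding norm_powr_of_real_exponent nX using w0[OF j] by (simp add: powr_diff)
  have "cmod (FK_H_alpha p b \<alpha> B \<rho> U j z * w j powr of_real (\<alpha> j - 1))
      \<le> 4 / cmod (X j) * (cmod (X j) / cmod (w j))"
    unfolding norm_mult pw FK_H_alpha_def i_def[symmetric] F
    using res(2) by (intro mult_right_mono) (simp_all add: norm_mult)
  also have "\<dots> \<le> 8 * r powr (- 1)"
    using X0[OF j] w0[OF j] w[OF j] r by (simp add: powr_minus field_simps)
  finally have 1: "cmod (FK_H_alpha p b \<alpha> B \<rho> U j z * w j powr of_real (\<alpha> j - 1)) \<le> 8 * r powr (- 1)" .
  have "cmod (FK_H p b \<alpha> B \<rho> U z * w j powr of_real (\<alpha> j - 1))
      \<le> 8 / (cmod (X j) * cmod (X i)) * (cmod (X j) / cmod (w j))"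
    unfolding norm_mult pw using res(1) by (intro mult_right_mono) simp_all
  also have "\<dots> = 32 / ((2 * cmod (w j)) * (2 * cmod (X i)))"
    using X0[OF j] by simp
  also have "\<dots> \<le> 32 / (r * r powr \<alpha> i)"
    using r w[OF j] rX[OF i] w0[OF j] X0[OF i]
    by (intro divide_left_mono mult_mono mult_pos_pos) auto
  also have "\<dots> = 32 * r powr (- 1 - \<alpha> i)"
    using r by (simp add: powr_diff powr_minus field_simps)
  finally have 2: "cmod (FK_H p b \<alpha> B \<rho> U z * w j powr of_real (\<alpha> j - 1)) \<le> 32 * r powr (- 1 - \<alpha> i)" .
  have "FK_Ghat p b \<alpha> B \<rho> U G0 j z
      = FK_H_alpha p b \<alpha> B \<rho> U j z * w j powr of_real (\<alpha> j - 1) * G0 j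
        - of_real (c i) * (FK_H p b \<alpha> B \<rho> U z * w j powr of_real (\<alpha> j - 1)) * G0 i"
    by (simp add: FK_Ghat_def w_def c_def i_def)
  also have "cmod \<dots> \<le> 8 * r powr (- 1) * cmod (G0 j)
      + \<bar>c i\<bar> * (32 * r powr (- 1 - \<alpha> i)) * cmod (G0 i)"
    unfolding norm_mult[of _ "G0 _"] norm_mult[of "of_real _"] norm_of_real real_norm_def
    by (intro order.trans[OF norm_triangle_ineq4] add_mono)
      (simp_all only: norm_mult[of _ "G0 _"] norm_mult[of "of_real _"] norm_of_real,
       intro mult_right_mono 1 norm_ge_zero, intro mult_right_mono mult_left_mono 2 norm_ge_zero abs_ge_zero)
  finally show ?thesis
    by (simp add: r_def i_def mult_ac)
qed

text \<open>
  Integrability on the contour has to come from measurability: for \<open>\<theta>\<close> near \<open>pi\<close> and complex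
  \<open>\<rho> * U j\<close> the contour may cross the branch cut, so the transform need not be continuous there.
\<close>

lemma borel_measurable_FK_Ghat [measurable]: "FK_Ghat p b \<alpha> B \<rho> U G0 j \<in> borel_measurable borel"
  unfolding FK_Ghat_def FK_H_alpha_def FK_H_def FK_factor_def powr_def by measurable


section \<open>Size of inverse Laplace integrals\<close>

text \<open>One exponent in \<open>le\<close> serves the whole contour: on the rays Re z < 0 and it
  decays as s Re z, while on the arc it is at most \<delta>T. The parameter q counts extra powers of
  |z|, and e is the additional decay of the coupled term.\<close>

lemma inverse_Laplace_bound:
  fixes f :: "complex \<Rightarrow> complex"
  assumes f: "f \<in> borel_measurable borel"
    and \<theta>: "\<theta> \<in> {pi / 2<..<pi}" and \<delta>: "0 < \<delta>" and s: "1 / \<delta> < s"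
    and A: "0 \<le> A" and C: "0 \<le> C" and e: "0 \<le> e" and q: "q \<le> 1" and T: "0 \<le> T"
    and le: "\<And>z. \<delta> \<le> cmod z \<Longrightarrow> cmod (f z) \<le>
      (A * cmod z powr (q - 1) + C * cmod z powr (q - 1 - e)) *
        exp (if Re z \<le> 0 then s * Re z else T * cmod z)"
  shows "Gamma_contour_integrable \<theta> \<delta> f"
    and "cmod (1 / (2 * of_real pi * \<i>) * Gamma_contour_integral \<theta> \<delta> f) \<le>
      C / pi * (- 1 / cos \<theta> * s powr (e - q) * exp (cos \<theta>)
        + 2 * \<theta> * \<delta> powr (q - e) * exp (\<delta> * T))
      + A / pi * (- 1 / cos \<theta> * s powr (- q) * exp (cos \<theta>)
        + 2 * \<theta> * \<delta> powr q * exp (\<delta> * T))"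
proof -
  \<comment> \<open>K is the sum of powers evaluated at |z| = 1/s; M is the majorant for |z| =
    \<delta>.\<close>
  define K where "K = A * s powr (1 - q) + C * s powr (1 - q + e)"
  define M where "M = (A * \<delta> powr (q - 1) + C * \<delta> powr (q - 1 - e)) * exp (\<delta> * T)"
  have cos: "cos \<theta> < 0"
    using \<theta> cos_monotone_0_pi[of "pi / 2" \<theta>] by auto
  have s0: "0 < s" and \<theta>0: "0 < \<theta>" and s\<delta>: "1 \<le> \<delta> * s"
    using s \<delta> \<theta> pi_gt_zero by (auto simp: field_simps intro: less_trans[of 0 "1 / \<delta>"])
  have M0: "0 \<le> M" and K0: "0 \<le> K"
    using A C by (simp_all add: M_def K_def)
  \<comment> \<open>To be applied with a = 1 - q and a = 1 - q + e, both nonnegative by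
    \<open>q\<close> and \<open>e\<close>.\<close>
  have decr: "r powr (- a) \<le> s powr a" if "\<delta> \<le> r" "0 \<le> a" for r a
  proof -
    have "1 / s \<le> r" using s0 s\<delta> that \<delta> 
      by (simp add: field_simps) (meson mult_right_mono less_imp_le order.trans)
    hence "r powr (- a) \<le> (1 / s) powr (- a)"
      using s0 that by (intro powr_mono2') auto
    thus ?thesis using s0 by (simp add: powr_divide powr_minus field_simps)
  qed
  have rays: "cmod (f (of_real r * cis \<phi>)) \<le> K * exp (r * (s * cos \<theta>))"
    if r: "\<delta> \<le> r" and \<phi>: "\<phi> \<in> {- \<theta>, \<theta>}" for r \<phi>
  proof -
    have cz: "cmod (of_real r * cis \<phi>) = r" using r \<delta> by (simp add: norm_mult)
    have Rz: "Re (of_real r * cis \<phi>) = r * cos \<theta>" using \<phi> by auto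
    have neg: "r * cos \<theta> \<le> 0" using cos r \<delta> by (simp add: mult_nonneg_nonpos)
    have "cmod (f (of_real r * cis \<phi>))
        \<le> (A * r powr (- (1 - q)) + C * r powr (- (1 - q + e))) * exp (s * (r * cos \<theta>))"
      using le[of "of_real r * cis \<phi>"] r neg unfolding cz Rz by (simp add: algebra_simps)
    also have "\<dots> \<le> K * exp (s * (r * cos \<theta>))"
      unfolding K_def using q e r
      by (intro mult_right_mono add_mono mult_left_mono A C decr) auto
    finally show ?thesis by (simp add: mult_ac)
  qed
  have arc: "cmod (f (of_real \<delta> * cis \<phi>)) \<le> M" for \<phi>
  proof -
    have cz: "cmod (of_real \<delta> * cis \<phi>) = \<delta>" using \<delta> by (simp add: norm_mult)
    have "(if Re (of_real \<delta> * cis \<phi>) \<le> 0 then s * Re (of_real \<delta> * cis \<phi>)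
        else T * cmod (of_real \<delta> * cis \<phi>)) \<le> \<delta> * T" (is "?m \<le> _")
      using s0 T \<delta> unfolding cz by (auto simp: mult_le_0_iff intro: order.trans[of _ 0])
    hence "(A * \<delta> powr (q - 1) + C * \<delta> powr (q - 1 - e)) * exp ?m \<le> M"
      unfolding M_def using A C by (intro mult_left_mono) auto
    thus ?thesis
      using le[of "of_real \<delta> * cis \<phi>"] unfolding cz by linarith
  qed
  note bounds = Gamma_contour_integral_bound[OF f \<theta>0 \<delta> s0 cos rays arc]
  show "Gamma_contour_integrable \<theta> \<delta> f"
    by (rule bounds(1))
  \<comment> \<open>As \<delta>s \<ge> 1 and cos \<theta> < 0, the exponential at the start of the
    rays is at most \<open>exp (cos \<theta>)\<close>.\<close>
  have "\<delta> * (s * cos \<theta>) \<le> cos \<theta>"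
    using mult_right_mono_neg[OF s\<delta>, of "cos \<theta>"] cos by (simp add: mult_ac)
  hence "2 * K * (exp (\<delta> * (s * cos \<theta>)) / - (s * cos \<theta>))
      \<le> 2 * K * (exp (cos \<theta>) / - (s * cos \<theta>))"
    using s0 cos K0 by (intro mult_left_mono divide_right_mono) (auto simp: mult_le_0_iff)
  also have "\<dots> = 2 * (K / s) * (- 1 / cos \<theta> * exp (cos \<theta>))"
    using s0 cos by (simp add: field_simps)
  \<comment> \<open>The 1/s from integrating the exponential lowers the powers to those in the
    claim.\<close>
  also have "K / s = A * s powr (- q) + C * s powr (e - q)"
    using s0 by (simp add: K_def powr_add powr_diff powr_minus field_simps)
  finally have R: "2 * K * (exp (\<delta> * (s * cos \<theta>)) / - (s * cos \<theta>))
      \<le> 2 * (A * s powr (- q) + C * s powr (e - q)) * (- 1 / cos \<theta> * exp (cos \<theta>))" .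
  have S: "\<delta> * M = (A * \<delta> powr q + C * \<delta> powr (q - e)) * exp (\<delta> * T)"
  proof -
    have "\<delta> * \<delta> powr (q - 1) = \<delta> powr q" "\<delta> * \<delta> powr (q - 1 - e) = \<delta> powr (q - e)"
      using \<delta> by (simp_all add: powr_mult_base)
    moreover have "\<delta> * M
        = (A * (\<delta> * \<delta> powr (q - 1)) + C * (\<delta> * \<delta> powr (q - 1 - e))) * exp (\<delta> * T)"
      unfolding M_def by (simp only: distrib_left distrib_right mult_ac)
    ultimately show ?thesis by simp
  qed
  have "cmod (1 / (2 * of_real pi * \<i>) * Gamma_contour_integral \<theta> \<delta> f)
      = cmod (Gamma_contour_integral \<theta> \<delta> f) / (2 * pi)"
    by (simp add: norm_mult norm_divide)
  \<comment> \<open>The arc term is doubled here, to match the coefficient 2\<theta> that the claim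
    has after division by 2 pi.\<close>
  also have "\<dots> \<le> (2 * K * (exp (\<delta> * (s * cos \<theta>)) / - (s * cos \<theta>)) + 4 * \<theta> * \<delta> * M) / (2 * pi)"
    using \<theta>0 \<delta> M0
    by (intro divide_right_mono order.trans[OF bounds(2)] add_left_mono mult_right_mono) auto
  also have "\<dots> \<le> (2 * (A * s powr (- q) + C * s powr (e - q)) * (- 1 / cos \<theta> * exp (cos \<theta>))
      + 4 * \<theta> * (\<delta> * M)) / (2 * pi)"
    using R by (intro divide_right_mono) simp_all
  also have "\<dots> = C / pi * (- 1 / cos \<theta> * s powr (e - q) * exp (cos \<theta>)
        + 2 * \<theta> * \<delta> powr (q - e) * exp (\<delta> * T))
      + A / pi * (- 1 / cos \<theta> * s powr (- q) * exp (cos \<theta>)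
        + 2 * \<theta> * \<delta> powr q * exp (\<delta> * T))"
    unfolding S using cos by (simp add: field_simps)
  finally show "cmod (1 / (2 * of_real pi * \<i>) * Gamma_contour_integral \<theta> \<delta> f) \<le> \<dots>" .
qed

section \<open>Derivative bounds from difference quotients on the left\<close>

text \<open>Quotients from the left suffice, which covers an endpoint such as t = T. The quotient at
  s is controlled by \<open>R s\<close>, and left continuity of R carries the bound to t.\<close>

lemma norm_vector_derivative_left_le:
  fixes f :: "real \<Rightarrow> 'a :: real_normed_vector"
  assumes f: "(f has_vector_derivative D) (at t within S)" and S: "{a<..<t} \<subseteq> S" and a: "a < t"
    and R: "(R \<longlongrightarrow> R t) (at_left t)"
    and le: "\<And>s. s \<in> {a<..<t} \<Longrightarrow> norm (f s - f t) \<le> (t - s) * R s"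
  shows "norm D \<le> R t"
proof -
  \<comment> \<open>The normalised remainder of the linear approximation: its norm is the distance
    between D and the difference quotient.\<close>
  define err where "err = (\<lambda>s. (1 / norm (s - t)) *\<^sub>R (f s - (f t + (s - t) *\<^sub>R D)))"
  have left: "at t within {a<..<t} = at_left t"
    using a by (intro at_within_nhd[of _ "{a<..}"]) auto
  have "(err \<longlongrightarrow> 0) (at t within S)"
    using f unfolding has_vector_derivative_def has_derivative_within err_def by blast
  hence "(err \<longlongrightarrow> 0) (at t within {a<..<t})"
    by (rule tendsto_within_subset) (rule S)
  hence lim: "((\<lambda>s. norm (err s) + R s) \<longlongrightarrow> 0 + R t) (at_left t)"
    unfolding left by (intro tendsto_add tendsto_norm_zero R)
  have "norm D \<le> norm (err s) + R s" if "s \<in> {a<..<t}" for s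
  proof -
    have "(t - s) *\<^sub>R err s = f s - (f t + (s - t) *\<^sub>R D)"
      using that by (simp add: err_def)
    hence "(t - s) *\<^sub>R D = (t - s) *\<^sub>R err s - (f s - f t)"
      by (simp add: algebra_simps)
    hence "(t - s) * norm D = norm ((t - s) *\<^sub>R err s - (f s - f t))"
      using that by (metis abs_of_pos diff_gt_0_iff_gt greaterThanLessThan_iff norm_scaleR)
    also have "\<dots> \<le> (t - s) * norm (err s) + (t - s) * R s"
      using norm_triangle_ineq4[of "(t - s) *\<^sub>R err s" "f s - f t"] le[OF that] that by simp
    finally have "(t - s) * norm D \<le> (t - s) * (norm (err s) + R s)"
      by (simp add: distrib_left)
    thus ?thesis using that by simp
  qed
  hence "eventually (\<lambda>s. norm D \<le> norm (err s) + R s) (at_left t)"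
    using eventually_at_left_real[OF a] by (auto elim: eventually_mono)
  from tendsto_lowerbound[OF lim this] show ?thesis by simp
qed

section \<open>The estimate for the solution and its derivative\<close>

theorem theorem2p1:
  fixes p b T \<theta> \<delta> t :: real
    and \<alpha> B :: "nat \<Rightarrow> real"
    and \<rho> :: complex
    and U G0 :: "nat \<Rightarrow> complex"
    and G :: "nat \<Rightarrow> real \<Rightarrow> complex"
    and q j :: nat
  assumes p: "p \<in> {0..1}" and b: "b \<in> {0..1}" and pb: "p + b \<noteq> 1"
    and B: "\<forall>k\<in>{1, 2}. inverse (B k) > 0"
    and \<theta>: "\<theta> \<in> {pi / 2<..<pi}"
    and \<alpha>: "\<forall>k\<in>{1, 2}. 0 < \<alpha> k \<and> \<alpha> k < 1"
    and \<delta>_pos: "\<delta> > 0"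
    and \<delta>: "\<delta> \<ge> max
           (MAX k\<in>{1, 2}. max (2 * cmod (\<rho> * U k))
              (4 powr (1 / \<alpha> k) * \<bar>m_coeff p b k * inverse (B k)\<bar> powr (1 / \<alpha> k)))
           ((32 * \<bar>m_coeff p b 1 * m_coeff p b 2 * inverse (B 1) * inverse (B 2)\<bar>)
              powr (1 / (\<alpha> 1 + \<alpha> 2)))"
    and solution: "FK_solution p b \<alpha> B \<rho> U T G0 G"
    and representation: "\<forall>k\<in>{1, 2}. \<forall>s\<in>{0<..T}.
           G k s = 1 / (2 * of_real pi * \<i>) *
             Gamma_contour_integral \<theta> \<delta>
               (\<lambda>z. exp (z * of_real s) * FK_Ghat p b \<alpha> B \<rho> U G0 k z)"
    and t: "t \<in> {0<..T}" "t > 1 / \<delta>"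
    and q: "q \<in> {0, 1}"
    and j: "j \<in> {1, 2}"
  shows "cmod (dt_iter T q (G j) t)
    \<le> 32 * \<bar>m_coeff p b (star j) * inverse (B (star j))\<bar> / pi *
        (- 1 / cos \<theta> * t powr (\<alpha> (star j) - real q) * exp (cos \<theta>)
         + 2 * \<theta> * \<delta> powr (real q - \<alpha> (star j)) * exp (\<delta> * T)) * cmod (G0 (star j))
    + 8 / pi *
        (- 1 / cos \<theta> * t powr (- real q) * exp (cos \<theta>)
         + 2 * \<theta> * \<delta> powr real q * exp (\<delta> * T)) * cmod (G0 j)"
proof -
  define c where "c = (\<lambda>k. m_coeff p b k * inverse (B k))"
  define Ghat where "Ghat = FK_Ghat p b \<alpha> B \<rho> U G0 j"
  define F where "F = (\<lambda>s z. exp (z * of_real s) * Ghat z)"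
  define A where "A = 8 * cmod (G0 j)"
  define C where "C = 32 * \<bar>c (star j)\<bar> * cmod (G0 (star j))"
  define e where "e = \<alpha> (star j)"
  \<comment> \<open>The claimed right-hand side, as a function of a real order and of time so that
    it can be evaluated at s < t as well.\<close>
  define R where "R = (\<lambda>q s.
      C / pi * (- 1 / cos \<theta> * s powr (e - q) * exp (cos \<theta>)
        + 2 * \<theta> * \<delta> powr (q - e) * exp (\<delta> * T))
      + A / pi * (- 1 / cos \<theta> * s powr (- q) * exp (cos \<theta>)
        + 2 * \<theta> * \<delta> powr q * exp (\<delta> * T)))"
  have [measurable]: "Ghat \<in> borel_measurable borel"
    by (simp add: Ghat_def)
  have AC: "0 \<le> A" "0 \<le> C" by (simp_all add: A_def C_def)
  have star: "star j \<in> {1, 2}" using j by (auto simp: star_def)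
  have e: "0 < e" using \<alpha> star by (auto simp: e_def)
  have T: "0 \<le> T" using t by simp
  have shift: "2 * cmod (\<rho> * U k) \<le> \<delta>"
    and c4: "4 powr (1 / \<alpha> k) * \<bar>c k\<bar> powr (1 / \<alpha> k) \<le> \<delta>" if "k \<in> {1, 2}" for k
    using \<delta> that by (auto simp: c_def)
  have cc: "(32 * \<bar>c 1 * c 2\<bar>) powr (1 / (\<alpha> 1 + \<alpha> 2)) \<le> \<delta>"
    using \<delta> by (simp add: c_def mult_ac)
  have Ghat: "cmod (Ghat z) \<le> A * cmod z powr (- 1) + C * cmod z powr (- 1 - e)"
    if z: "\<delta> \<le> cmod z" for z
    unfolding A_def C_def Ghat_def e_def c_def
  proof (rule norm_FK_Ghat_le[OF j])
    show "z \<noteq> 0" using z \<delta>_pos by auto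
    show "0 < \<alpha> k \<and> \<alpha> k < 1" if "k \<in> {1, 2}" for k using \<alpha> that by blast
    show "2 * cmod (\<rho> * U k) \<le> cmod z" if "k \<in> {1, 2}" for k
      using shift[OF that] z by linarith
    \<comment> \<open>The two powers in \<open>c4\<close> combine to
      \<open>(4 * \<bar>c k\<bar>) powr (1 / \<alpha> k)\<close>.\<close>
    show "4 * \<bar>m_coeff p b k * inverse (B k)\<bar> \<le> cmod z powr \<alpha> k" if "k \<in> {1, 2}" for k
      using c4[OF that] z \<alpha> that
      by (intro powr_le_imp_le_powr) (auto simp: c_def powr_mult)
    show "32 * \<bar>m_coeff p b 1 * inverse (B 1) * (m_coeff p b 2 * inverse (B 2))\<bar>
        \<le> cmod z powr (\<alpha> 1 + \<alpha> 2)"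
      using cc z \<alpha> by (intro powr_le_imp_le_powr) (auto simp: c_def)
  qed
  \<comment> \<open>Used with w = exp (zs), d = 1, q' = 0 for the values and with w = exp (zs) - exp
    (zt), d = t - s, q' = 1 for the differences.\<close>
  have bound: "Gamma_contour_integrable \<theta> \<delta> (\<lambda>z. w z * Ghat z) \<and>
      cmod (1 / (2 * of_real pi * \<i>) * Gamma_contour_integral \<theta> \<delta> (\<lambda>z. w z * Ghat z)) \<le> d * R q' s"
    if s: "1 / \<delta> < s" and q': "q' \<le> 1" and d: "0 \<le> d" and [measurable]: "w \<in> borel_measurable borel"
      and w: "\<And>z. z \<noteq> 0 \<Longrightarrow> cmod (w z) \<le>
        d * cmod z powr q' * exp (if Re z \<le> 0 then s * Re z else T * cmod z)" for d q' s w
  proof -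
    have le: "cmod (w z * Ghat z) \<le> ((d * A) * cmod z powr (q' - 1) + (d * C) * cmod z powr (q' - 1 - e)) *
        exp (if Re z \<le> 0 then s * Re z else T * cmod z)" (is "_ \<le> _ * ?E") if z: "\<delta> \<le> cmod z" for z
    proof -
      have z0: "z \<noteq> 0" using z \<delta>_pos by auto
      have "cmod (w z * Ghat z) \<le> (d * cmod z powr q' * ?E) *
          (A * cmod z powr (- 1) + C * cmod z powr (- 1 - e))"
        unfolding norm_mult using w[OF z0] Ghat[OF z] d by (intro mult_mono) auto
      also have "\<dots> = (d * A * (cmod z powr q' * cmod z powr (- 1))
          + d * C * (cmod z powr q' * cmod z powr (- 1 - e))) * ?E"
        by (simp add: algebra_simps)
      also have "cmod z powr q' * cmod z powr (- 1) = cmod z powr (q' - 1)"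
        unfolding powr_add[symmetric] by simp
      also have "cmod z powr q' * cmod z powr (- 1 - e) = cmod z powr (q' - 1 - e)"
        unfolding powr_add[symmetric] by (simp_all add: algebra_simps)
      finally show ?thesis .
    qed
    have "d * R q' s = d * C / pi * (- 1 / cos \<theta> * s powr (e - q') * exp (cos \<theta>)
        + 2 * \<theta> * \<delta> powr (q' - e) * exp (\<delta> * T))
      + d * A / pi * (- 1 / cos \<theta> * s powr (- q') * exp (cos \<theta>)
        + 2 * \<theta> * \<delta> powr q' * exp (\<delta> * T))"
      unfolding R_def by (simp only: distrib_left mult.assoc flip: times_divide_eq_right)
    moreover have "0 \<le> d * A" "0 \<le> d * C" "0 \<le> e"
      using AC d e by simp_all
    note inverse_Laplace_bound[OF _ \<theta> \<delta>_pos s this q' T le]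
    moreover have "(\<lambda>z. w z * Ghat z) \<in> borel_measurable borel"
      by measurable
    ultimately show ?thesis by presburger
  qed
  have s0: "0 < s" if "1 / \<delta> < s" for s
    using that \<delta>_pos by (meson divide_pos_pos less_trans zero_less_one)
  \<comment> \<open>For Re z \<le> 0 the earlier time s' gives the larger exponent, and otherwise T
    |z| dominates; one majorant thus serves two times.\<close>
  have exp_le: "Re (z * of_real s) \<le> (if Re z \<le> 0 then s' * Re z else T * cmod z)"
    if "s' \<le> s" "s \<le> T" "0 \<le> s" for s s' z
    using that complex_Re_le_cmod[of z] T
    by (auto simp: mult.commute intro!: mult_mono mult_right_mono_neg)
  have F: "Gamma_contour_integrable \<theta> \<delta> (F s) \<and>
      cmod (1 / (2 * of_real pi * \<i>) * Gamma_contour_integral \<theta> \<delta> (F s)) \<le> 1 * R 0 s"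
    if s: "1 / \<delta> < s" "s \<le> T" for s
    unfolding F_def
  proof (rule bound)
    fix z
    have "exp (Re (z * of_real s)) \<le> exp (if Re z \<le> 0 then s * Re z else T * cmod z)" (is "_ \<le> exp ?m")
      unfolding exp_le_cancel_iff using s s0[of s] by (intro exp_le) auto
    \<comment> \<open>Since \<open>0 powr 0 = 0\<close>, the factor \<open>cmod z powr 0\<close>
      equals 1 only away from the origin.\<close>
    moreover assume "z \<noteq> 0"
    hence "1 * cmod z powr 0 * exp ?m = exp ?m" by simp
    ultimately show "cmod (exp (z * of_real s)) \<le> 1 * cmod z powr 0 * exp ?m"
      unfolding norm_exp_eq_Re by argo
  qed (use s in auto)
  have G: "G j s = 1 / (2 * of_real pi * \<i>) * Gamma_contour_integral \<theta> \<delta> (F s)"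
    if "s \<in> {0<..T}" for s
    using representation j that unfolding F_def Ghat_def by blast
  have "cmod (dt_iter T q (G j) t) \<le> R (real q) t"
  proof (cases "q = 0")
    case True
    thus ?thesis using conjunct2[OF F[of t]] t by (simp add: dt_iter_def G)
  next
    case False
    hence q1: "q = 1" using q by auto
    \<comment> \<open>This makes the total \<open>vector_derivative\<close> behind \<open>dt\<close>
      a genuine derivative.\<close>
    have "G j differentiable (at t within {0<..T})"
      using solution j t unfolding FK_solution_def by blast
    hence der: "(G j has_vector_derivative dt T (G j) t) (at t within {0<..T})"
      by (simp add: dt_def vector_derivative_works)
    have "cmod (dt T (G j) t) \<le> R 1 t"
    proof (rule norm_vector_derivative_left_le[OF der _ t(2)])
      show "{1 / \<delta><..<t} \<subseteq> {0<..T}"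
        using s0 t by auto
      show "(R 1 \<longlongrightarrow> R 1 t) (at_left t)"
        unfolding R_def using t by (intro tendsto_intros) auto
      fix s assume s: "s \<in> {1 / \<delta><..<t}"
      have sT: "1 / \<delta> < s" "s < t" "0 < s" "s \<le> T" "t \<le> T"
        using s t s0[of s] by auto
      have "G j s - G j t = 1 / (2 * of_real pi * \<i>) *
          (Gamma_contour_integral \<theta> \<delta> (F s) - Gamma_contour_integral \<theta> \<delta> (F t))"
        using G[of s] G[of t] sT by (simp add: right_diff_distrib)
      also have "Gamma_contour_integral \<theta> \<delta> (F s) - Gamma_contour_integral \<theta> \<delta> (F t)
          = Gamma_contour_integral \<theta> \<delta> (\<lambda>z. F s z - F t z)"
        using F[of s] F[of t] sT
        by (intro Gamma_contour_integral_diff[symmetric]) auto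
      also have "(\<lambda>z. F s z - F t z) = (\<lambda>z. (exp (z * of_real s) - exp (z * of_real t)) * Ghat z)"
        by (simp add: F_def left_diff_distrib)
      finally have eq: "G j s - G j t = 1 / (2 * of_real pi * \<i>) *
          Gamma_contour_integral \<theta> \<delta> (\<lambda>z. (exp (z * of_real s) - exp (z * of_real t)) * Ghat z)" .
      \<comment> \<open>Both exponents lie below the majorant of the earlier time s, and |zs - zt|
        supplies t - s and the extra power of |z|.\<close>
      have "cmod (exp (z * of_real s) - exp (z * of_real t)) \<le>
          (t - s) * cmod z powr 1 * exp (if Re z \<le> 0 then s * Re z else T * cmod z)" (is "_ \<le> _ * exp ?m")
        for z
      proof -
        have "cmod (exp (z * of_real s) - exp (z * of_real t))
            \<le> exp ?m * cmod (z * of_real s - z * of_real t)"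
          using sT by (intro norm_exp_diff_le exp_le) auto
        also have "z * of_real s - z * of_real t = z * of_real (s - t)"
          by (simp add: algebra_simps)
        finally show ?thesis
          using sT by (simp only: norm_mult norm_of_real) (simp add: mult_ac)
      qed
      thus "cmod (G j s - G j t) \<le> (t - s) * R 1 s"
        unfolding eq using sT by (intro conjunct2[OF bound]) auto
    qed
    thus ?thesis by (simp add: q1 dt_iter_def)
  qed
  thus ?thesis
    unfolding R_def A_def C_def e_def c_def
    by (simp only: times_divide_eq_left times_divide_eq_right mult_ac)
qed

end
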